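(* Let $x$ be an oscillatory solution of $$x''(t)+p(t)x(t-\tau(t))=0,\qquad t\ge s,$$ with $p(t)\le 0$ for $t\in\mathbb{R}$, and assume that $$\tau_m\sqrt{\operatorname{ess\,sup}_{t\in\mathbb{R}}|p(t)|}\le\gamma ,$$ where $\gamma$ is the unique solution of $\Psi(1,\gamma)=\gamma\in[\sqrt2,\tfrac{\pi}{2}]$. Then $x(t)$ is bounded. If, further, the inequality is strict, i.e. $\tau_m\sqrt{\operatorname{ess\,sup}_{t\in\mathbb{R}}|p(t)|}<\gamma$, then $x(t)\to 0$ as $t\to+\infty$.
   Context: Equation and solutions. $\tau:\mathbb{R}\to[0,+\infty)$ and $p:\mathbb{R}\to\mathbb{R}$ are Lebesgue measurable and essentially bounded. $\tau_m:=\operatorname{ess\,sup}\{\tau(t):t\ge s\}$. A solution on $[s,+\infty)$ is a function $x:[s-\tau_m,+\infty)\to\mathbb{R}$, absolutely continuous together with its first derivative, satisfying the equation a.e. on $[s,+\infty)$. A function is oscillatory if it has arbitrarily large zeros. The function $r_\Delta$ and the number $\vartheta_\Delta$. For $\Delta\ge 0$, $r_\Delta:\mathbb{R}\to\mathbb{R}$ is the solution of $r_\Delta''(t)+r_\Delta(t-\Delta)=0$ for $t\ge 0$, with $r_\Delta(t)=1$ for $t\le 0$ and $r_\Delta'(0)=0$. $\vartheta_\Delta>0$ denotes its first zero (it is known that $r_\Delta$ is strictly decreasing on $[0,\vartheta_\Delta]$ and that $\vartheta_\Delta\geq\sqrt2$ is continuous in $\Delta$; for $\Delta=0$, $r_0=\cos$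 on $[0,+\infty)$ and $\vartheta_0=\pi/2$). The number $\Psi(\rho,\Delta)$. Let $\chi_S$ be the characteristic function of $S\subset\mathbb{R}$. For $\Delta\in[0,+\infty)$, $\rho\in(0,+\infty)$ set $\beta_0(t)\equiv 1$ for $t\le 0$ and, for $n=0,1,2,\dots$, let $\varpi_n\in(0,+\infty)$ be the unique number with $$\int_{-\varpi_n}^{0}\Big[\int_{-\varpi_n}^{u}\max\{\beta_n(v),\rho\, r_\Delta(\vartheta_\Delta-v-\Delta)\chi_{[-\Delta,0]}(v)\}\,dv\Big]du=1,$$ and put $\beta_{n+1}(t)=1$ for $t\le-\varpi_n$ and $$\beta_{n+1}(t)=1-\int_{-\varpi_n}^{t}\Big[\int_{-\varpi_n}^{u}\max\{\beta_n(v),\rho\, r_\Delta(\vartheta_\Delta-v-\Delta)\chi_{[-\Delta,0]}(v)\}\,dv\Big]du,\qquad t\in[-\varpi_n,0].$$ The sequence $\varpi_n$ is well-defined, nondecreasing and bounded, and $\Psi(\rho,\Delta):=\lim_{n\to\infty}\varpi_n$. The function $\Delta\mapsto\Psi(1,\Delta)$ is continuous and nonincreasing, so that the equation $\Psi(1,\gamma)=\gamma$ has a unique solution $\gamma$, and it lies in $[\sqrt2,\pi/2]$. *)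

theory Defs
  imports "HOL-Probability.Essential_Supremum"
begin

section \<open>Absolute continuity and essential bounds\<close>

text \<open>A pair \<open>(u, v)\<close> stands for the interval from \<open>u\<close> to \<open>v\<close>.\<close>

definition ac_on_interval :: "real \<Rightarrow> real \<Rightarrow> (real \<Rightarrow> real) \<Rightarrow> bool" where
  "ac_on_interval a b f \<longleftrightarrow>
     (\<forall>\<epsilon>>0. \<exists>\<delta>>0. \<forall>D :: (real \<times> real) set.
        finite D \<longrightarrow> (\<forall>(u, v)\<in>D. a \<le> u \<and> u \<le> v \<and> v \<le> b) \<longrightarrow>
        disjoint_family_on (\<lambda>(u, v). {u<..<v}) D \<longrightarrow>
        (\<Sum>(u, v)\<in>D. v - u) < \<delta> \<longrightarrow> (\<Sum>(u, v)\<in>D. \<bar>f v - f u\<bar>) < \<epsilon>)"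

text \<open>On an unbounded half-line, absolute continuity is understood on every compact
  subinterval.\<close>

definition ac_on_halfline :: "real \<Rightarrow> (real \<Rightarrow> real) \<Rightarrow> bool" where
  "ac_on_halfline a f \<longleftrightarrow> (\<forall>b\<ge>a. ac_on_interval a b f)"

definition ess_bounded :: "(real \<Rightarrow> real) \<Rightarrow> bool" where
  "ess_bounded f \<longleftrightarrow> (\<exists>C. AE t in lebesgue. \<bar>f t\<bar> \<le> C)"

definition ess_sup_on :: "real set \<Rightarrow> (real \<Rightarrow> real) \<Rightarrow> real" where
  "ess_sup_on S f = real_of_ereal (esssup (lebesgue_on S) (\<lambda>t. ereal (f t)))"

section \<open>The delay equation\<close>

definition max_delay :: "real \<Rightarrow> (real \<Rightarrow> real) \<Rightarrow> real" where
  "max_delay s \<tau> = ess_sup_on {s..} \<tau>"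

text \<open>A solution lives on \<open>[s - \<tau>\<^sub>m, \<infinity>)\<close>; the values of the total function \<open>x\<close> to the left of this
  half-line are irrelevant, and the derivative at its endpoint is one-sided.\<close>

definition delay_solution ::
    "real \<Rightarrow> (real \<Rightarrow> real) \<Rightarrow> (real \<Rightarrow> real) \<Rightarrow> (real \<Rightarrow> real) \<Rightarrow> bool" where
  "delay_solution s p \<tau> x \<longleftrightarrow>
     (\<exists>x'. (\<forall>t \<ge> s - max_delay s \<tau>.
              (x has_real_derivative x' t) (at t within {s - max_delay s \<tau>..})) \<and>
           ac_on_halfline (s - max_delay s \<tau>) x \<and>
           ac_on_halfline (s - max_delay s \<tau>) x' \<and>
           (AE t in lebesgue_on {s..}.
              \<exists>x''. (x' has_real_derivative x'') (at t) \<and> x'' + p t * x (t - \<tau> t) = 0))"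

definition oscillatory :: "(real \<Rightarrow> real) \<Rightarrow> bool" where
  "oscillatory x \<longleftrightarrow> (\<forall>T. \<exists>t\<ge>T. x t = 0)"

section \<open>The function \<open>r\<^sub>\<Delta>\<close> and the quantity \<open>\<Psi>(\<rho>, \<Delta>)\<close>\<close>

definition r_fun :: "real \<Rightarrow> real \<Rightarrow> real" where
  "r_fun \<Delta> = (THE r. delay_solution 0 (\<lambda>_. 1) (\<lambda>_. \<Delta>) r \<and>
                 (\<forall>t\<le>0. r t = 1) \<and> (r has_real_derivative 0) (at 0))"

definition first_zero :: "real \<Rightarrow> real" where
  "first_zero \<Delta> = (LEAST t. 0 < t \<and> r_fun \<Delta> t = 0)"

definition kernel :: "real \<Rightarrow> real \<Rightarrow> (real \<Rightarrow> real) \<Rightarrow> real \<Rightarrow> real" where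
  "kernel \<rho> \<Delta> \<beta> v =
     max (\<beta> v) (\<rho> * r_fun \<Delta> (first_zero \<Delta> - v - \<Delta>) * indicator {-\<Delta>..0} v)"

definition double_integral :: "(real \<Rightarrow> real) \<Rightarrow> real \<Rightarrow> real \<Rightarrow> real" where
  "double_integral g a t = integral {a..t} (\<lambda>u. integral {a..u} g)"

definition unit_width :: "(real \<Rightarrow> real) \<Rightarrow> real" where
  "unit_width g = (THE w. 0 < w \<and> double_integral g (- w) 0 = 1)"

text \<open>Only the values of \<open>\<beta>\<^sub>n\<close> on \<open>(-\<infinity>, 0]\<close> are meaningful.\<close>

primrec beta :: "real \<Rightarrow> real \<Rightarrow> nat \<Rightarrow> real \<Rightarrow> real" where
  "beta \<rho> \<Delta> 0 = (\<lambda>t. 1)"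
| "beta \<rho> \<Delta> (Suc n) =
     (let g = kernel \<rho> \<Delta> (beta \<rho> \<Delta> n); w = unit_width g
      in (\<lambda>t. if t \<le> - w then 1 else 1 - double_integral g (- w) t))"

definition varpi :: "real \<Rightarrow> real \<Rightarrow> nat \<Rightarrow> real" where
  "varpi \<rho> \<Delta> n = unit_width (kernel \<rho> \<Delta> (beta \<rho> \<Delta> n))"

definition Psi :: "real \<Rightarrow> real \<Rightarrow> real" where
  "Psi \<rho> \<Delta> = lim (varpi \<rho> \<Delta>)"

end

theory Submission
  imports Defs
begin

text \<open>Choose \<open>k\<close> with \<open>\<bar>p\<bar> \<le> k\<^sup>2\<close> almost everywhere and \<open>k \<tau>\<^sub>m \<le> \<pi> / 2\<close>. If \<open>\<bar>x\<bar> \<le> N\<close> before a zero \<open>a\<close>, then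
  \<open>\<bar>x''\<bar> \<le> k\<^sup>2 N\<close> there, and convexity gives \<open>\<bar>x (a - w)\<bar> \<le> 3/2 k N w\<close>. On a positive bump starting
  at \<open>a\<close>, concavity can only come from the negative values before \<open>a\<close>, so
  \<open>x''(a + v) \<ge> - 3/2 k\<^sup>3 N (\<tau>\<^sub>m - v)\<close> for \<open>v \<le> \<tau>\<^sub>m\<close> and \<open>x'' \<ge> 0\<close> later. Integrating twice from the maximum,
  where \<open>x' = 0\<close>, bounds the height of the bump by \<open>(k \<tau>\<^sub>m)\<^sup>3 N / 4 < N\<close>. Hence the sup norm contracts
  past every sufficiently late zero.\<close>

section \<open>Absolutely continuous functions\<close>

lemma ac_on_interval_subset:
  assumes "ac_on_interval a b f" "a \<le> c" "d \<le> b"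
  shows "ac_on_interval c d f"
  unfolding ac_on_interval_def
proof (intro allI impI)
  fix \<epsilon> :: real assume "\<epsilon> > 0"
  then obtain \<delta> where "\<delta> > 0" and \<delta>: "\<And>D :: (real \<times> real) set. finite D \<Longrightarrow>
      (\<forall>(u, v)\<in>D. a \<le> u \<and> u \<le> v \<and> v \<le> b) \<Longrightarrow>
      disjoint_family_on (\<lambda>(u, v). {u<..<v}) D \<Longrightarrow>
      (\<Sum>(u, v)\<in>D. v - u) < \<delta> \<Longrightarrow> (\<Sum>(u, v)\<in>D. \<bar>f v - f u\<bar>) < \<epsilon>"
    using assms(1) unfolding ac_on_interval_def by meson
  have "(\<Sum>(u, v)\<in>D. \<bar>f v - f u\<bar>) < \<epsilon>"
    if "finite D" "\<forall>(u, v)\<in>D. c \<le> u \<and> u \<le> v \<and> v \<le> d"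
      "disjoint_family_on (\<lambda>(u, v). {u<..<v}) D" "(\<Sum>(u, v)\<in>D. v - u) < \<delta>"
    for D :: "(real \<times> real) set"
    using that assms(2,3) by (intro \<delta>) fastforce+
  with \<open>\<delta> > 0\<close> show "\<exists>\<delta>>0. \<forall>D :: (real \<times> real) set. finite D \<longrightarrow>
      (\<forall>(u, v)\<in>D. c \<le> u \<and> u \<le> v \<and> v \<le> d) \<longrightarrow>
      disjoint_family_on (\<lambda>(u, v). {u<..<v}) D \<longrightarrow>
      (\<Sum>(u, v)\<in>D. v - u) < \<delta> \<longrightarrow> (\<Sum>(u, v)\<in>D. \<bar>f v - f u\<bar>) < \<epsilon>"
    by blast
qed

lemma ac_on_interval_uminus:
  "ac_on_interval a b f \<Longrightarrow> ac_on_interval a b (\<lambda>t. - f t)"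
  unfolding ac_on_interval_def by (simp add: abs_minus_commute)

text \<open>Over disjoint intervals of small total length, \<open>G\<close> varies by at most
  \<open>C\<close> times that length, which adds to the variation of \<open>f\<close>. This permits
  subtracting a comparison function in \<open>ac_increment_ge\<close>.\<close>

lemma ac_on_interval_diff_lipschitz:
  assumes f: "ac_on_interval a b f"
    and G: "\<And>u v. a \<le> u \<Longrightarrow> u \<le> v \<Longrightarrow> v \<le> b \<Longrightarrow> \<bar>G v - G u\<bar> \<le> C * (v - u)"
    and "C \<ge> 0"
  shows "ac_on_interval a b (\<lambda>t. f t - G t)"
  unfolding ac_on_interval_def
proof (intro allI impI)
  fix \<epsilon> :: real assume "\<epsilon> > 0"
  then have "\<epsilon> / 2 > 0" by simp
  with f obtain \<delta> where "\<delta> > 0" and \<delta>: "\<And>D :: (real \<times> real) set. finite D \<Longrightarrow>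
      (\<forall>(u, v)\<in>D. a \<le> u \<and> u \<le> v \<and> v \<le> b) \<Longrightarrow>
      disjoint_family_on (\<lambda>(u, v). {u<..<v}) D \<Longrightarrow>
      (\<Sum>(u, v)\<in>D. v - u) < \<delta> \<Longrightarrow> (\<Sum>(u, v)\<in>D. \<bar>f v - f u\<bar>) < \<epsilon> / 2"
    unfolding ac_on_interval_def by meson
  \<comment> \<open>Half of \<epsilon> is allotted to each function; \<open>C + 1\<close> avoids
    dividing by zero when \<open>C = 0\<close>.\<close>
  define \<eta> where "\<eta> = min \<delta> (\<epsilon> / (2 * (C + 1)))"
  have "\<eta> > 0"
    using \<open>\<delta> > 0\<close> \<open>\<epsilon> > 0\<close> \<open>C \<ge> 0\<close> by (simp add: \<eta>_def)
  have small_variation: "(\<Sum>(u, v)\<in>D. \<bar>f v - G v - (f u - G u)\<bar>) < \<epsilon>"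
    if D: "finite D" "\<forall>(u, v)\<in>D. a \<le> u \<and> u \<le> v \<and> v \<le> b"
      "disjoint_family_on (\<lambda>(u, v). {u<..<v}) D" and small: "(\<Sum>(u, v)\<in>D. v - u) < \<eta>"
    for D :: "(real \<times> real) set"
  proof -
    have "(\<Sum>(u, v)\<in>D. \<bar>f v - G v - (f u - G u)\<bar>)
        \<le> (\<Sum>(u, v)\<in>D. \<bar>f v - f u\<bar> + C * (v - u))"
    proof (rule sum_mono)
      fix z assume "z \<in> D"
      with D(2) G[of "fst z" "snd z"]
      show "(case z of (u, v) \<Rightarrow> \<bar>f v - G v - (f u - G u)\<bar>)
          \<le> (case z of (u, v) \<Rightarrow> \<bar>f v - f u\<bar> + C * (v - u))"
        by (auto simp: split_beta)
    qed
    also have "\<dots> = (\<Sum>(u, v)\<in>D. \<bar>f v - f u\<bar>) + C * (\<Sum>(u, v)\<in>D. v - u)"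
      by (simp add: split_beta sum.distrib sum_distrib_left)
    also have "\<dots> < \<epsilon> / 2 + \<epsilon> / 2"
    proof (rule add_less_le_mono)
      show "(\<Sum>(u, v)\<in>D. \<bar>f v - f u\<bar>) < \<epsilon> / 2"
        using small by (intro \<delta> D) (simp add: \<eta>_def)
      have "C * (\<Sum>(u, v)\<in>D. v - u) \<le> C * (\<epsilon> / (2 * (C + 1)))"
        using small \<open>C \<ge> 0\<close> by (intro mult_left_mono) (simp_all add: \<eta>_def)
      also have "\<dots> \<le> \<epsilon> / 2"
        using \<open>C \<ge> 0\<close> \<open>\<epsilon> > 0\<close> by (simp add: field_simps)
      finally show "C * (\<Sum>(u, v)\<in>D. v - u) \<le> \<epsilon> / 2" .
    qed
    finally show ?thesis by simp
  qed
  show "\<exists>\<delta>>0. \<forall>D :: (real \<times> real) set. finite D \<longrightarrow>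
      (\<forall>(u, v)\<in>D. a \<le> u \<and> u \<le> v \<and> v \<le> b) \<longrightarrow>
      disjoint_family_on (\<lambda>(u, v). {u<..<v}) D \<longrightarrow>
      (\<Sum>(u, v)\<in>D. v - u) < \<delta> \<longrightarrow> (\<Sum>(u, v)\<in>D. \<bar>f v - G v - (f u - G u)\<bar>) < \<epsilon>"
    by (intro exI[of _ \<eta>] conjI \<open>\<eta> > 0\<close> allI impI) (rule small_variation)
qed

section \<open>Monotonicity from a nonnegative derivative almost everywhere\<close>

text \<open>One interval may carry two tags, but then its interior is disjoint from itself, hence
  empty, and its term vanishes. Absolute continuity and measure additivity speak of sets of
  intervals, so the tags have to be dropped.\<close>

lemma sum_tagged_partial_division_snd:
  fixes q :: "(real \<times> real set) set"
  assumes "q tagged_partial_division_of {a..b}"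
    and d0: "\<And>K. K \<in> snd ` q \<Longrightarrow> measure lborel K = 0 \<Longrightarrow> d K = 0"
  shows "(\<Sum>(t, K)\<in>q. d K) = (\<Sum>K\<in>snd ` q. (d K :: real))"
proof -
  have "(\<Sum>(t, K)\<in>q. d K) = (\<Sum>z\<in>q. d (snd z))"
    by (simp add: split_beta)
  also have "\<dots> = sum d (snd ` q)"
  proof (rule sum.reindex_nontrivial[symmetric, unfolded o_def])
    show "finite q" using assms(1) by (rule tagged_partial_division_ofD(1))
    fix y z assume yz: "y \<in> q" "z \<in> q" "y \<noteq> z" "snd y = snd z"
    obtain t K t' where [simp]: "y = (t, K)" "z = (t', K)"
      using yz by (metis prod.collapse)
    have K: "\<exists>u v. K = cbox u v"
      using tagged_partial_division_ofD(4)[OF assms(1), of t K] yz(1) by auto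
    have "interior K = {}"
      using tagged_partial_division_ofD(5)[OF assms(1), of t K t' K] yz by auto
    then have "measure lborel K = 0"
      using K content_eq_0_interior by metis
    then show "d (snd y) = 0"
      using d0 yz(1) by force
  qed
  finally show ?thesis .
qed

text \<open>A gauge argument replaces Lebesgue integration. In a fine tagged division, intervals
  tagged outside \<open>Z\<close> lose at most \<epsilon> times their length by differentiability at
  the tag; those tagged in \<open>Z\<close> lie in an open set of small measure, where absolute
  continuity bounds the total variation.\<close>

lemma ac_nonneg_derivative_imp_le:
  assumes ac: "ac_on_interval a b f" and "a \<le> b"
    and null: "Z \<in> null_sets lebesgue"
    and deriv: "\<And>t. t \<in> {a..b} - Z \<Longrightarrow> \<exists>D\<ge>0. (f has_real_derivative D) (at t)"
  shows "f a \<le> f b"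
proof (rule field_le_epsilon)
  fix e :: real assume "e > 0"
  \<comment> \<open>The loss is \<epsilon> on the intervals tagged in \<open>Z\<close> and at most
    \<open>\<epsilon> * (b - a)\<close> on the others, \<open>e\<close> in total.\<close>
  define \<epsilon> where "\<epsilon> = e / (1 + (b - a))"
  have "\<epsilon> > 0" and \<epsilon>: "\<epsilon> * (1 + (b - a)) = e"
    using \<open>e > 0\<close> \<open>a \<le> b\<close> by (auto simp: \<epsilon>_def)
  obtain \<delta> where "\<delta> > 0" and \<delta>: "\<And>D :: (real \<times> real) set. finite D \<Longrightarrow>
      (\<forall>(u, v)\<in>D. a \<le> u \<and> u \<le> v \<and> v \<le> b) \<Longrightarrow>
      disjoint_family_on (\<lambda>(u, v). {u<..<v}) D \<Longrightarrow>
      (\<Sum>(u, v)\<in>D. v - u) < \<delta> \<Longrightarrow> (\<Sum>(u, v)\<in>D. \<bar>f v - f u\<bar>) < \<epsilon>"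
    using ac \<open>\<epsilon> > 0\<close> unfolding ac_on_interval_def by meson
  obtain U where U: "open U" "Z \<subseteq> U" "U - Z \<in> lmeasurable" "emeasure lebesgue (U - Z) < ennreal \<delta>"
    using sets_lebesgue_outer_open[of Z \<delta>] null \<open>\<delta> > 0\<close> by blast
  have U_meas: "U \<in> lmeasurable" "measure lebesgue U < \<delta>"
  proof -
    have "emeasure lebesgue U = emeasure lebesgue (U - Z)"
      using emeasure_Diff_null_set[OF null, of U] U(1) by simp
    then show "U \<in> lmeasurable" "measure lebesgue U < \<delta>"
      using U \<open>\<delta> > 0\<close> by (auto simp: fmeasurable_def measure_def less_top ennreal_less_iff enn2real_less_iff
          intro: order.strict_trans)
  qed
  \<comment> \<open>The gauge: at points of \<open>Z\<close> the ball stays inside \<open>U\<close>;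
    elsewhere in \<open>{a..b}\<close> it is small enough for the straddle inequality. Outside both
    sets any radius will do.\<close>
  have "\<exists>r>0. (t \<in> Z \<longrightarrow> ball t r \<subseteq> U) \<and> (t \<in> {a..b} - Z \<longrightarrow>
      (\<forall>u v. u \<le> t \<longrightarrow> t \<le> v \<longrightarrow> {u..v} \<subseteq> ball t r \<longrightarrow> f v - f u \<ge> - \<epsilon> * (v - u)))" for t
  proof (cases "t \<in> Z")
    case True
    then show ?thesis using U openE by blast
  next
    case False
    show ?thesis
    proof (cases "t \<in> {a..b}")
      case True
      then obtain D where "D \<ge> 0" and D: "(f has_real_derivative D) (at t)"
        using deriv \<open>t \<notin> Z\<close> by blast
      then obtain r where "r > 0"
        and r: "\<And>y. \<bar>y - t\<bar> < r \<Longrightarrow> \<bar>f y - f t - D * (y - t)\<bar> \<le> \<epsilon> * \<bar>y - t\<bar>"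
        using \<open>\<epsilon> > 0\<close> unfolding has_field_derivative_def has_derivative_within_alt
        by fastforce
      have "f v - f u \<ge> - \<epsilon> * (v - u)" if uv: "u \<le> t" "t \<le> v" "{u..v} \<subseteq> ball t r" for u v
      proof -
        have "u \<in> {u..v}" "v \<in> {u..v}" using uv by auto
        then have "\<bar>u - t\<bar> < r" "\<bar>v - t\<bar> < r"
          using uv(3) by (auto simp: dist_real_def abs_minus_commute subset_iff)
        \<comment> \<open>The increment is split at the tag \<open>t\<close>; since \<open>D\<close>
          is nonnegative, both linear parts help and only the error terms remain.\<close>
        then have "f v - f t \<ge> D * (v - t) - \<epsilon> * (v - t)" "f u - f t \<le> D * (u - t) + \<epsilon> * (t - u)"
          using r[of u] r[of v] uv by auto
        moreover have "D * (v - t) \<ge> 0" "D * (u - t) \<le> 0"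
          using \<open>D \<ge> 0\<close> uv by (auto intro: mult_nonneg_nonpos)
        ultimately show ?thesis by (simp add: algebra_simps)
      qed
      with \<open>r > 0\<close> \<open>t \<notin> Z\<close> show ?thesis by blast
    next
      case False
      with \<open>t \<notin> Z\<close> show ?thesis by (intro exI[of _ 1]) auto
    qed
  qed
  then obtain r where "\<And>t. r t > 0" and rZ: "\<And>t. t \<in> Z \<Longrightarrow> ball t (r t) \<subseteq> U"
    and rf: "\<And>t u v. t \<in> {a..b} - Z \<Longrightarrow> u \<le> t \<Longrightarrow> t \<le> v \<Longrightarrow> {u..v} \<subseteq> ball t (r t) \<Longrightarrow>
      f v - f u \<ge> - \<epsilon> * (v - u)"
    by metis
  then have "gauge (\<lambda>t. ball t (r t))"
    by (simp add: gauge_def)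
  then obtain p where p: "p tagged_division_of {a..b}" and fine: "(\<lambda>t. ball t (r t)) fine p"
    using fine_division_exists_real by blast
  have p_props: "\<exists>u v. K = {u..v} \<and> u \<le> t \<and> t \<le> v \<and> a \<le> u \<and> v \<le> b \<and> {u..v} \<subseteq> ball t (r t) \<and> t \<in> {a..b}"
    if mem: "(t, K) \<in> p" for t K
  proof -
    obtain u v where K: "K = {u..v}" using tagged_division_ofD(4)[OF p mem] by auto
    moreover have "t \<in> K" "K \<subseteq> {a..b}" using tagged_division_ofD(2,3)[OF p mem] by auto
    ultimately show ?thesis using fineD[OF fine mem]
      by (intro exI[of _ u] exI[of _ v]) auto
  qed
  define q where "q = {z\<in>p. fst z \<in> Z}"
  have "finite p" using p by blast
  have qp: "q \<subseteq> p" by (auto simp: q_def)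
  have q: "q tagged_partial_division_of {a..b}"
    using p by (intro tagged_partial_division_subset[OF _ qp]) (simp add: tagged_division_of_def)
  note qdiv = partial_division_of_tagged_division[OF q]
  have K_props: "K = {Inf K..Sup K}" "Inf K \<le> Sup K" "a \<le> Inf K" "Sup K \<le> b" "K \<subseteq> U"
    if mem: "K \<in> snd ` q" for K
  proof -
    obtain t where "(t, K) \<in> p" "t \<in> Z"
      using mem unfolding q_def by auto
    moreover obtain u v where "K = {u..v}" "u \<le> t" "t \<le> v" "a \<le> u" "v \<le> b" "{u..v} \<subseteq> ball t (r t)"
      using p_props[OF \<open>(t, K) \<in> p\<close>] by blast
    ultimately show "K = {Inf K..Sup K}" "Inf K \<le> Sup K" "a \<le> Inf K" "Sup K \<le> b" "K \<subseteq> U"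
      using rZ[of t] by auto
  qed
  have K_content: "measure lborel K = Sup K - Inf K" "measure lebesgue K = Sup K - Inf K"
    if "K \<in> snd ` q" for K
  proof -
    have "measure lborel {Inf K..Sup K} = Sup K - Inf K" "measure lebesgue {Inf K..Sup K} = Sup K - Inf K"
      using K_props(2)[OF that] by auto
    then show "measure lborel K = Sup K - Inf K" "measure lebesgue K = Sup K - Inf K"
      by (simp_all only: K_props(1)[OF that, symmetric])
  qed
  have bad: "(\<Sum>(t, K)\<in>q. \<bar>f (Sup K) - f (Inf K)\<bar>) < \<epsilon>"
  proof -
    \<comment> \<open>Intervals are encoded by their endpoints, as in
      \<open>ac_on_interval_def\<close>; this is injective because each one equals
      \<open>{Inf K..Sup K}\<close>.\<close>
    define D where "D = (\<lambda>K. (Inf K, Sup K)) ` snd ` q"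
    have inj: "inj_on (\<lambda>K. (Inf K, Sup K)) (snd ` q)"
    proof (rule inj_onI)
      fix K L assume "K \<in> snd ` q" "L \<in> snd ` q" "(Inf K, Sup K) = (Inf L, Sup L)"
      then show "K = L" using K_props(1)[of K] K_props(1)[of L] by simp
    qed
    have "(\<Sum>(t, K)\<in>q. \<bar>f (Sup K) - f (Inf K)\<bar>) = (\<Sum>K\<in>snd ` q. \<bar>f (Sup K) - f (Inf K)\<bar>)"
      using K_content by (intro sum_tagged_partial_division_snd[OF q]) fastforce
    also have "\<dots> = (\<Sum>(u, v)\<in>D. \<bar>f v - f u\<bar>)"
      unfolding D_def by (simp add: sum.reindex[OF inj])
    also have "\<dots> < \<epsilon>"
    proof (rule \<delta>)
      show "finite D" using finite_subset[OF qp \<open>finite p\<close>] by (simp add: D_def)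
      show "\<forall>(u, v)\<in>D. a \<le> u \<and> u \<le> v \<and> v \<le> b"
        using K_props(2-4) by (auto simp: D_def)
      show "disjoint_family_on (\<lambda>(u, v). {u<..<v}) D"
      proof (unfold disjoint_family_on_def, intro ballI impI)
        fix y z assume yz: "y \<in> D" "z \<in> D" "y \<noteq> z"
        then obtain K L where KL: "K \<in> snd ` q" "L \<in> snd ` q" "y = (Inf K, Sup K)" "z = (Inf L, Sup L)"
          unfolding D_def by blast
        with yz(3) have "K \<noteq> L" by auto
        then have "interior K \<inter> interior L = {}"
          using division_ofD(5)[OF qdiv] KL by blast
        moreover have "interior K = {Inf K<..<Sup K}"
          using interior_atLeastAtMost_real[of "Inf K" "Sup K"]
          by (simp only: K_props(1)[OF KL(1), symmetric])
        moreover have "interior L = {Inf L<..<Sup L}"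
          using interior_atLeastAtMost_real[of "Inf L" "Sup L"]
          by (simp only: K_props(1)[OF KL(2), symmetric])
        ultimately show "(case y of (u, v) \<Rightarrow> {u<..<v}) \<inter> (case z of (u, v) \<Rightarrow> {u<..<v}) = {}"
          using KL by simp
      qed
      \<comment> \<open>The intervals overlap only in endpoints, so their total length is the
        measure of their union, which lies in \<open>U\<close>.\<close>
      have "(\<Sum>(u, v)\<in>D. v - u) = (\<Sum>K\<in>snd ` q. Sup K - Inf K)"
        unfolding D_def by (simp add: sum.reindex[OF inj])
      also have "\<dots> = sum (measure lebesgue) (snd ` q)"
        using K_content by (intro sum.cong) auto
      also have "\<dots> = measure lebesgue (\<Union>(snd ` q))"
        by (rule content_division[OF qdiv])
      also have "\<dots> \<le> measure lebesgue U"
        using K_props(5) qdiv U_meas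
        by (intro measure_mono_fmeasurable fmeasurableD lmeasurable_division[OF qdiv]) blast+
      finally show "(\<Sum>(u, v)\<in>D. v - u) < \<delta>" using U_meas by simp
    qed
    finally show ?thesis .
  qed
  have "f b - f a = (\<Sum>(t, K)\<in>p. f (Sup K) - f (Inf K))"
    by (rule additive_tagged_division_1[OF \<open>a \<le> b\<close> p, symmetric])
  also have "\<dots> = (\<Sum>(t, K)\<in>q. f (Sup K) - f (Inf K)) + (\<Sum>(t, K)\<in>p - q. f (Sup K) - f (Inf K))"
    using sum.subset_diff[OF qp \<open>finite p\<close>] by (simp add: add.commute)
  also have "\<dots> \<ge> - (\<Sum>(t, K)\<in>q. \<bar>f (Sup K) - f (Inf K)\<bar>) + (\<Sum>(t, K)\<in>p - q. - \<epsilon> * (Sup K - Inf K))"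
  proof (rule add_mono)
    show "- (\<Sum>(t, K)\<in>q. \<bar>f (Sup K) - f (Inf K)\<bar>) \<le> (\<Sum>(t, K)\<in>q. f (Sup K) - f (Inf K))"
      unfolding sum_negf[symmetric] by (intro sum_mono) auto
    show "(\<Sum>(t, K)\<in>p - q. - \<epsilon> * (Sup K - Inf K)) \<le> (\<Sum>(t, K)\<in>p - q. f (Sup K) - f (Inf K))"
    proof (rule sum_mono)
      fix z assume z: "z \<in> p - q"
      obtain t K where [simp]: "z = (t, K)" by force
      obtain u v where K: "K = {u..v}" "u \<le> t" "t \<le> v" "{u..v} \<subseteq> ball t (r t)" "t \<in> {a..b}"
        using p_props[of t K] z by auto
      moreover have "t \<notin> Z" using z by (auto simp: q_def)
      ultimately show "(case z of (t, K) \<Rightarrow> - \<epsilon> * (Sup K - Inf K)) \<le> (case z of (t, K) \<Rightarrow> f (Sup K) - f (Inf K))"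
        using rf[of t u v] by simp
    qed
  qed
  finally have "f b - f a \<ge> - (\<Sum>(t, K)\<in>q. \<bar>f (Sup K) - f (Inf K)\<bar>) + (\<Sum>(t, K)\<in>p - q. - \<epsilon> * (Sup K - Inf K))" .
  \<comment> \<open>Putting the terms of \<open>q\<close> back only lowers the bound, and the sum
    over all of \<open>p\<close> telescopes.\<close>
  moreover have "(\<Sum>(t, K)\<in>p - q. - \<epsilon> * (Sup K - Inf K)) \<ge> (\<Sum>(t, K)\<in>p. - \<epsilon> * (Sup K - Inf K))"
  proof -
    have "(\<Sum>(t, K)\<in>q. \<epsilon> * (Sup K - Inf K)) \<ge> 0"
    proof (rule sum_nonneg)
      fix z assume "z \<in> q"
      then have "Inf (snd z) \<le> Sup (snd z)" by (intro K_props(2)) auto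
      then show "0 \<le> (case z of (t, K) \<Rightarrow> \<epsilon> * (Sup K - Inf K))"
        using \<open>\<epsilon> > 0\<close> by (simp add: split_beta)
    qed
    then show ?thesis
      using sum.subset_diff[OF qp \<open>finite p\<close>, of "\<lambda>(t, K). - \<epsilon> * (Sup K - Inf K)"]
      by (simp add: split_beta sum_negf)
  qed
  moreover have "(\<Sum>(t, K)\<in>p. - \<epsilon> * (Sup K - Inf K)) = - \<epsilon> * (b - a)"
    using additive_tagged_division_1[OF \<open>a \<le> b\<close> p, of "\<lambda>t. - \<epsilon> * t"] by (simp add: algebra_simps)
  ultimately have "f b - f a \<ge> - \<epsilon> - \<epsilon> * (b - a)"
    using bad by linarith
  moreover have "e = \<epsilon> + \<epsilon> * (b - a)"
    unfolding \<epsilon>[symmetric] by (simp only: distrib_left mult_1_right)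
  ultimately show "f a \<le> f b + e"
    by linarith
qed

text \<open>This integrates the inequality \<open>f' \<ge> g\<close> known only almost everywhere:
  \<open>G\<close> is Lipschitz by the mean value theorem, so \<open>f - G\<close> is absolutely
  continuous with nonnegative derivative almost everywhere.\<close>

lemma ac_increment_ge:
  assumes ac: "ac_on_interval a b f" and "a \<le> b"
    and deriv: "AE t in lebesgue. t \<in> {a..b} \<longrightarrow> (\<exists>D\<ge>g t. (f has_real_derivative D) (at t))"
    and G: "\<And>t. (G has_real_derivative g t) (at t)"
    and g: "\<And>t. t \<in> {a..b} \<Longrightarrow> \<bar>g t\<bar> \<le> C"
  shows "G b - G a \<le> f b - f a"
proof -
  obtain Z where Z: "Z \<in> null_sets lebesgue"
    "\<And>t. t \<in> {a..b} - Z \<Longrightarrow> \<exists>D\<ge>g t. (f has_real_derivative D) (at t)"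
    using deriv by (auto elim!: AE_E3)
  have "C \<ge> 0"
    using g[of a] \<open>a \<le> b\<close> by auto
  have "\<bar>G v - G u\<bar> \<le> C * (v - u)" if uv: "a \<le> u" "u \<le> v" "v \<le> b" for u v
  proof (cases "u = v")
    case False
    then obtain z where z: "u < z" "z < v" "G v - G u = (v - u) * g z"
      using MVT2[of u v G g] G uv by (metis less_le)
    then have "\<bar>G v - G u\<bar> = (v - u) * \<bar>g z\<bar>"
      by (simp add: abs_mult)
    also have "\<dots> \<le> (v - u) * C"
      using g[of z] z that by (intro mult_left_mono) auto
    finally show ?thesis by (simp add: mult.commute)
  qed simp
  then have "ac_on_interval a b (\<lambda>t. f t - G t)"
    using ac_on_interval_diff_lipschitz[OF ac] \<open>C \<ge> 0\<close> by blast
  then have "f a - G a \<le> f b - G b"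
  proof (rule ac_nonneg_derivative_imp_le[OF _ \<open>a \<le> b\<close> Z(1)])
    fix t assume "t \<in> {a..b} - Z"
    then obtain D where "D \<ge> g t" "(f has_real_derivative D) (at t)"
      using Z(2) by blast
    then show "\<exists>D\<ge>0. ((\<lambda>t. f t - G t) has_real_derivative D) (at t)"
      using G[of t] by (intro exI[of _ "D - g t"]) (auto intro!: derivative_intros)
  qed
  then show ?thesis by simp
qed

section \<open>Essential suprema\<close>

lemma AE_le_ess_sup_on:
  assumes f: "f \<in> borel_measurable lebesgue" and "ess_bounded f" and S: "S \<in> sets lebesgue"
  shows "AE t in lebesgue. t \<in> S \<longrightarrow> f t \<le> ess_sup_on S f"
proof -
  obtain C where "AE t in lebesgue. \<bar>f t\<bar> \<le> C"
    using \<open>ess_bounded f\<close> unfolding ess_bounded_def by blast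
  then have C: "AE t in lebesgue_on S. ereal (f t) \<le> ereal C"
    using S by (subst AE_restrict_space_iff) (auto elim!: eventually_mono)
  have "(\<lambda>t. ereal (f t)) \<in> borel_measurable (lebesgue_on S)"
    using f by (intro borel_measurable_ereal measurable_restrict_space1)
  then have "esssup (lebesgue_on S) (\<lambda>t. ereal (f t)) \<le> ereal C"
    using C by (rule esssup_I)
  moreover have "AE t in lebesgue_on S. ereal (f t) \<le> esssup (lebesgue_on S) (\<lambda>t. ereal (f t))"
    by (rule esssup_AE)
  ultimately have "AE t in lebesgue_on S. f t \<le> ess_sup_on S f"
    unfolding ess_sup_on_def
    \<comment> \<open>\<open>real_of_ereal\<close> sends infinities to 0. The value
      \<open>\<infinity>\<close> is excluded by \<open>C\<close>; the value
      \<open>-\<infinity>\<close> contradicts the inequality at each point where it holds.\<close>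
    by (elim eventually_mono, cases "esssup (lebesgue_on S) (\<lambda>t. ereal (f t))") auto
  then show ?thesis
    using S by (subst (asm) AE_restrict_space_iff) auto
qed

section \<open>Decay of oscillatory solutions\<close>

text \<open>\<open>1571 / 1000\<close> is a rational number just above \<open>\<pi> / 2\<close> whose cube is less than \<open>4\<close>.\<close>

locale delayed_growth =
  fixes x x' :: "real \<Rightarrow> real" and s \<Delta> k :: real
  assumes delay_nonneg: "0 \<le> \<Delta>" and k_pos: "0 < k" and delay_le: "k * \<Delta> \<le> 1571 / 1000"
    and deriv: "\<And>t. s - \<Delta> \<le> t \<Longrightarrow> (x has_real_derivative x' t) (at t within {s - \<Delta>..})"
    and ac: "ac_on_halfline (s - \<Delta>) x'"
    and growth: "AE t in lebesgue. s \<le> t \<longrightarrow> (\<exists>q u. 0 \<le> q \<and> q \<le> k\<^sup>2 \<and> t - \<Delta> \<le> u \<and> u \<le> t \<and>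
      (x' has_real_derivative q * x u) (at t))"
begin

section \<open>Sign symmetry, comparison of slopes and the estimate before a zero\<close>

text \<open>The growth condition is linear in \<open>x\<close>. The symmetry turns lower bounds on
  slope increments into upper bounds and reduces negative bumps to positive ones.\<close>

lemma uminus: "delayed_growth (\<lambda>t. - x t) (\<lambda>t. - x' t) s \<Delta> k"
proof
  show "((\<lambda>t. - x t) has_real_derivative - x' t) (at t within {s - \<Delta>..})" if "s - \<Delta> \<le> t" for t
    using deriv[OF that] by (rule DERIV_minus)
  show "ac_on_halfline (s - \<Delta>) (\<lambda>t. - x' t)"
    using ac by (simp add: ac_on_halfline_def ac_on_interval_uminus)
  show "AE t in lebesgue. s \<le> t \<longrightarrow> (\<exists>q u. 0 \<le> q \<and> q \<le> k\<^sup>2 \<and> t - \<Delta> \<le> u \<and> u \<le> t \<and>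
      ((\<lambda>t. - x' t) has_real_derivative q * - x u) (at t))"
    using growth
  proof eventually_elim
    case (elim t)
    show ?case
    proof
      assume "s \<le> t"
      then obtain q u where "0 \<le> q" "q \<le> k\<^sup>2" "t - \<Delta> \<le> u" "u \<le> t"
        and D: "(x' has_real_derivative q * x u) (at t)"
        using elim by blast
      moreover have "((\<lambda>t. - x' t) has_real_derivative q * - x u) (at t)"
        using DERIV_minus[OF D] by simp
      ultimately show "\<exists>q u. 0 \<le> q \<and> q \<le> k\<^sup>2 \<and> t - \<Delta> \<le> u \<and> u \<le> t \<and>
          ((\<lambda>t. - x' t) has_real_derivative q * - x u) (at t)"
        by blast
    qed
  qed
qed (fact delay_nonneg k_pos delay_le)+

lemma inverse_k_pos: "0 < 1 / k"
  using k_pos by simp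

lemma deriv_at:
  assumes "s - \<Delta> < t"
  shows "(x has_real_derivative x' t) (at t)"
  using deriv[of t] assms at_within_interior[of t "{s - \<Delta>..}"] by auto

lemma continuous: "continuous_on {s - \<Delta>..} x"
  using deriv by (auto simp: continuous_on_eq_continuous_within intro: DERIV_continuous)

text \<open>The bound \<open>g\<close> is required for every admissible coefficient \<open>q\<close>
  and delayed time \<open>u\<close>, so applications need only information on \<open>x\<close> over
  \<open>{t - \<Delta>..t}\<close>.\<close>

lemma slope_increment_ge:
  assumes "s \<le> a" "a \<le> b" and "\<And>t. (G has_real_derivative g t) (at t)"
    and "\<And>t. t \<in> {a..b} \<Longrightarrow> \<bar>g t\<bar> \<le> C"
    and g: "\<And>t q u. t \<in> {a..b} \<Longrightarrow> 0 \<le> q \<Longrightarrow> q \<le> k\<^sup>2 \<Longrightarrow> t - \<Delta> \<le> u \<Longrightarrow> u \<le> t \<Longrightarrow> g t \<le> q * x u"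
  shows "G b - G a \<le> x' b - x' a"
proof (rule ac_increment_ge)
  have "ac_on_interval (s - \<Delta>) b x'"
    using ac assms(1,2) delay_nonneg by (auto simp: ac_on_halfline_def)
  then show "ac_on_interval a b x'"
    by (rule ac_on_interval_subset) (use assms(1) delay_nonneg in auto)
  show "AE t in lebesgue. t \<in> {a..b} \<longrightarrow> (\<exists>D\<ge>g t. (x' has_real_derivative D) (at t))"
    using growth
  proof eventually_elim
    case (elim t)
    show ?case
    proof
      assume t: "t \<in> {a..b}"
      then obtain q u where "0 \<le> q" "q \<le> k\<^sup>2" "t - \<Delta> \<le> u" "u \<le> t"
        "(x' has_real_derivative q * x u) (at t)"
        using elim \<open>s \<le> a\<close> by auto
      with g[OF t] show "\<exists>D\<ge>g t. (x' has_real_derivative D) (at t)"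
        by blast
    qed
  qed
qed (fact assms)+

text \<open>Where \<open>\<bar>x\<bar> \<le> N\<close>, the function \<open>- x\<close> plus a parabola with second derivative \<open>k\<^sup>2 N\<close> is
  convex, so that it lies below its chord over the interval of length \<open>1 / k\<close> ending at \<open>a\<close>.\<close>

lemma neg_le_before_zero:
  assumes zero: "x a = 0" and a: "s < a - 1 / k"
    and bd: "\<And>t. a - 1 / k - \<Delta> \<le> t \<Longrightarrow> t \<le> a \<Longrightarrow> \<bar>x t\<bar> \<le> N"
    and t: "a - 1 / k - \<Delta> \<le> t" "t \<le> a"
  shows "- x t \<le> 3 / 2 * k * N * (a - t)"
proof -
  have "N \<ge> 0"
    using bd[of a] abs_ge_zero[of "x a"] inverse_k_pos delay_nonneg by (smt (verit))
  show ?thesis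
  proof (cases "t \<le> a - 1 / k")
    \<comment> \<open>At distance at least \<open>1 / k\<close> from \<open>a\<close> the claimed
      bound is already at least \<open>N\<close>.\<close>
    case True
    then have "1 \<le> k * (a - t)"
      using k_pos by (simp add: field_simps)
    then have "N * 1 \<le> N * (3 / 2 * (k * (a - t)))"
      using \<open>N \<ge> 0\<close> by (intro mult_left_mono) auto
    then show ?thesis
      using bd[OF t] by (simp add: algebra_simps)
  next
    case False
    define Z where "Z = (\<lambda>t. - x t + k\<^sup>2 * N / 2 * (t - a)\<^sup>2)"
    have convex: "convex_on {a - 1 / k..a} Z"
    proof (rule convex_on_realI)
      fix u assume u: "u \<in> {a - 1 / k..a}"
      then have "s - \<Delta> < u" using a delay_nonneg by auto
      then show "(Z has_real_derivative - x' u + k\<^sup>2 * N * (u - a)) (at u)"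
        unfolding Z_def by (auto intro!: derivative_eq_intros deriv_at simp: power2_eq_square)
    next
      fix u v assume uv: "u \<in> {a - 1 / k..a}" "v \<in> {a - 1 / k..a}" "u \<le> v"
      interpret neg: delayed_growth "\<lambda>t. - x t" "\<lambda>t. - x' t" s \<Delta> k
        by (rule uminus)
      have "- (k\<^sup>2 * N) * v - - (k\<^sup>2 * N) * u \<le> - x' v - - x' u"
      proof (rule neg.slope_increment_ge)
        show "((\<lambda>t. - (k\<^sup>2 * N) * t) has_real_derivative - (k\<^sup>2 * N)) (at t)" for t
          by (auto intro!: derivative_eq_intros)
        fix t q w assume *: "t \<in> {u..v}" "0 \<le> q" "q \<le> k\<^sup>2" "t - \<Delta> \<le> w" "w \<le> t"
        \<comment> \<open>Delayed times of points in \<open>{a - 1 / k..a}\<close> reach back to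
          \<open>a - 1 / k - \<Delta>\<close>, whence the window in \<open>bd\<close>.\<close>
        have "x w \<le> N"
          using bd[of w] * uv by auto
        then have "q * x w \<le> k\<^sup>2 * N"
          using * \<open>N \<ge> 0\<close> by (meson mult_left_mono mult_right_mono order.trans)
        then show "- (k\<^sup>2 * N) \<le> q * - x w" by simp
      qed (use uv a in auto)
      then show "- x' u + k\<^sup>2 * N * (u - a) \<le> - x' v + k\<^sup>2 * N * (v - a)"
        by (simp add: algebra_simps)
    qed auto
    define \<mu> where "\<mu> = k * (a - t)"
    have \<mu>: "0 \<le> \<mu>" "\<mu> \<le> 1"
      using False t k_pos by (auto simp: \<mu>_def field_simps)
    have t_eq: "t = (1 - \<mu>) * a + \<mu> * (a - 1 / k)"
      using k_pos by (simp add: \<mu>_def field_simps)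
    have "- x t \<le> Z t"
      using \<open>N \<ge> 0\<close> by (simp add: Z_def)
    also have "Z t \<le> (1 - \<mu>) * Z a + \<mu> * Z (a - 1 / k)"
      using convex_onD[OF convex \<mu>, of a "a - 1 / k"] k_pos by (simp add: t_eq[symmetric])
    also have "\<dots> \<le> \<mu> * (3 / 2 * N)"
    proof -
      \<comment> \<open>The constant is 1 + 1/2: \<open>N\<close> from \<open>- x\<close>, and
        \<open>N / 2\<close> from the parabola at distance \<open>1 / k\<close>.\<close>
      have "Z (a - 1 / k) \<le> 3 / 2 * N"
        using bd[of "a - 1 / k"] k_pos delay_nonneg by (auto simp: Z_def power_divide abs_le_iff)
      moreover have "Z a = 0" by (simp add: Z_def zero)
      ultimately show ?thesis
        using mult_left_mono[of "Z (a - 1 / k)" "3 / 2 * N" \<mu>] \<mu>(1) by simp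
    qed
    finally show ?thesis by (simp add: \<mu>_def mult_ac)
  qed
qed

section \<open>The height of one bump\<close>

lemma bump_le:
  assumes zero: "x a = 0" and a: "s < a - 1 / k" and "a \<le> m"
    and pos: "\<And>t. a < t \<Longrightarrow> t \<le> m \<Longrightarrow> 0 < x t" and crit: "x' m = 0"
    and bd: "\<And>t. a - 1 / k - \<Delta> \<le> t \<Longrightarrow> t \<le> a \<Longrightarrow> \<bar>x t\<bar> \<le> N"
  shows "x m \<le> 97 / 100 * N"
proof -
  have "N \<ge> 0"
    using bd[of a] abs_ge_zero[of "x a"] inverse_k_pos delay_nonneg by (smt (verit))
  have "s < a" "s - \<Delta> < a"
    using a inverse_k_pos delay_nonneg by linarith+
  have nonneg: "0 \<le> x t" if "a \<le> t" "t \<le> m" for t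
    using pos[of t] zero that by (cases "t = a") auto
  \<comment> \<open>Past \<open>a + \<Delta>\<close> the delayed time is at least \<open>a\<close>,
    where \<open>x\<close> is nonnegative up to \<open>m\<close>; only before it can negative values
    of \<open>x\<close> bend the bump down.\<close>
  define n where "n = min m (a + \<Delta>)"
  have n: "a \<le> n" "n \<le> m" "n \<le> a + \<Delta>"
    using \<open>a \<le> m\<close> delay_nonneg by (auto simp: n_def)
  have slope_late: "x' t \<le> 0" if "n \<le> t" "t \<le> m" for t
  proof (cases "n = m")
    case False
    then have "n = a + \<Delta>" by (auto simp: n_def)
    \<comment> \<open>Here \<open>x'\<close> is nondecreasing and vanishes at \<open>m\<close>, so
      it is nonpositive; thus \<open>x\<close> falls from \<open>n\<close> to \<open>m\<close> and
      it suffices to bound \<open>x n\<close>.\<close>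
    have "(\<lambda>_. 0) m - (\<lambda>_. 0) t \<le> x' m - x' t"
      by (rule slope_increment_ge[where C = 0 and g = "\<lambda>_. 0"])
        (use that n \<open>n = a + \<Delta>\<close> \<open>s < a\<close> nonneg in \<open>auto intro!: mult_nonneg_nonneg\<close>)
    then show ?thesis using crit by simp
  qed (use that crit in auto)
  have "x m \<le> x n"
  proof (rule DERIV_nonpos_imp_nonincreasing[OF n(2)])
    fix t assume "n \<le> t" "t \<le> m"
    then show "\<exists>y. (x has_real_derivative y) (at t) \<and> y \<le> 0"
      using n \<open>s - \<Delta> < a\<close> slope_late by (intro exI[of _ "x' t"] conjI deriv_at) auto
  qed
  \<comment> \<open>The coefficient bound \<open>k\<^sup>2\<close> times the constant
    \<open>3 / 2 * k * N\<close> from \<open>neg_le_before_zero\<close>.\<close>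
  define c where "c = 3 / 2 * k ^ 3 * N"
  have "c \<ge> 0" using \<open>N \<ge> 0\<close> k_pos by (simp add: c_def)
  have slope_early: "x' t \<le> c / 2 * (a + \<Delta> - t)\<^sup>2" if t: "a \<le> t" "t \<le> n" for t
  proof -
    have "c / 2 * (a + \<Delta> - n)\<^sup>2 - c / 2 * (a + \<Delta> - t)\<^sup>2 \<le> x' n - x' t"
    proof (rule slope_increment_ge)
      show "((\<lambda>t. c / 2 * (a + \<Delta> - t)\<^sup>2) has_real_derivative - c * (a + \<Delta> - v)) (at v)" for v
        by (auto intro!: derivative_eq_intros simp: field_simps)
      show "\<bar>- c * (a + \<Delta> - v)\<bar> \<le> c * \<Delta>" if "v \<in> {t..n}" for v
        using that t n \<open>c \<ge> 0\<close> by (auto simp: abs_mult intro!: mult_left_mono)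
      fix v q u assume v: "v \<in> {t..n}" and q: "0 \<le> q" "q \<le> k\<^sup>2" and u: "v - \<Delta> \<le> u" "u \<le> v"
      have cv: "0 \<le> c * (a + \<Delta> - v)"
        using v n \<open>c \<ge> 0\<close> by auto
      show "- c * (a + \<Delta> - v) \<le> q * x u"
      proof (cases "0 \<le> x u")
        case True
        then have "0 \<le> q * x u" using q by simp
        then show ?thesis using cv by linarith
      next
        case False
        \<comment> \<open>A delayed time with negative value precedes \<open>a\<close>, and
          \<open>u \<ge> v - \<Delta>\<close> keeps it within \<open>a + \<Delta> - v\<close> of
          \<open>a\<close>.\<close>
        then have "u < a" using nonneg[of u] u v n by force
        then have "- x u \<le> 3 / 2 * k * N * (a - u)"
          using inverse_k_pos v u t unfolding atLeastAtMost_iff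
          by (intro neg_le_before_zero[OF zero a bd]) linarith+
        also have "\<dots> \<le> 3 / 2 * k * N * (a + \<Delta> - v)"
          using k_pos \<open>N \<ge> 0\<close> u by (intro mult_left_mono) auto
        finally have "k\<^sup>2 * - x u \<le> k\<^sup>2 * (3 / 2 * k * N * (a + \<Delta> - v))"
          by (intro mult_left_mono) auto
        moreover have "q * - x u \<le> k\<^sup>2 * - x u"
          using q False by (intro mult_right_mono) auto
        moreover have "k\<^sup>2 * (3 / 2 * k * N * (a + \<Delta> - v)) = c * (a + \<Delta> - v)"
          by (simp add: c_def power2_eq_square power3_eq_cube)
        ultimately show ?thesis
          by linarith
      qed
    qed (use t \<open>s < a\<close> in auto)
    moreover have "0 \<le> c / 2 * (a + \<Delta> - n)\<^sup>2"
      using \<open>c \<ge> 0\<close> by simp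
    ultimately show ?thesis
      using slope_late[of n] n by linarith
  qed
  \<comment> \<open>The second integration: the cubic has derivative
    \<open>- c / 2 * (a + \<Delta> - t)\<^sup>2\<close>, which offsets the slope bound just
    proved.\<close>
  have "x n + c / 6 * (a + \<Delta> - n) ^ 3 \<le> x a + c / 6 * (a + \<Delta> - a) ^ 3"
  proof (rule DERIV_nonpos_imp_nonincreasing[OF n(1)])
    fix t assume t: "a \<le> t" "t \<le> n"
    have "(x has_real_derivative x' t) (at t)"
      using t \<open>s - \<Delta> < a\<close> by (intro deriv_at) linarith
    then have "((\<lambda>t. x t + c / 6 * (a + \<Delta> - t) ^ 3) has_real_derivative
        x' t - c / 2 * (a + \<Delta> - t)\<^sup>2) (at t)"
      by (auto intro!: derivative_eq_intros simp: field_simps)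
    then show "\<exists>y. ((\<lambda>t. x t + c / 6 * (a + \<Delta> - t) ^ 3) has_real_derivative y) (at t) \<and> y \<le> 0"
      using slope_early[OF t] by (intro exI conjI) auto
  qed
  moreover have "0 \<le> c / 6 * (a + \<Delta> - n) ^ 3"
    using \<open>c \<ge> 0\<close> n by auto
  ultimately have "x n \<le> c / 6 * \<Delta> ^ 3"
    using zero by simp
  also have "\<dots> = (k * \<Delta>) ^ 3 / 4 * N"
    by (simp add: c_def power_mult_distrib)
  \<comment> \<open>The cube of 1.571 divided by 4 is about 0.9693, which explains the factor
    \<open>97 / 100\<close>.\<close>
  also have "\<dots> \<le> (1571 / 1000) ^ 3 / 4 * N"
    using delay_le delay_nonneg k_pos \<open>N \<ge> 0\<close>
    by (intro mult_right_mono divide_right_mono power_mono) auto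
  also have "\<dots> \<le> 97 / 100 * N"
    using \<open>N \<ge> 0\<close> by (intro mult_right_mono) (auto simp: power3_eq_cube)
  finally show ?thesis using \<open>x m \<le> x n\<close> by simp
qed

text \<open>A bump containing \<open>m\<close> starts at the last zero \<open>d\<close> before
  \<open>m\<close>. Between \<open>a\<close> and \<open>d\<close> only the bound \<open>x m\<close>
  is available, so \<open>bump_le\<close> is applied with \<open>max N (x m)\<close>; as
  \<open>97 / 100 < 1\<close> and \<open>x m > 0\<close>, the maximum must be
  \<open>N\<close>.\<close>

lemma positive_max_le:
  assumes zero: "x a = 0" "x b = 0" and a: "s < a - 1 / k" and m: "a \<le> m" "m \<le> b" "0 < x m"
    and max: "\<And>t. a \<le> t \<Longrightarrow> t \<le> b \<Longrightarrow> \<bar>x t\<bar> \<le> x m"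
    and bd: "\<And>t. a - 1 / k - \<Delta> \<le> t \<Longrightarrow> t \<le> a \<Longrightarrow> \<bar>x t\<bar> \<le> N"
  shows "x m \<le> 97 / 100 * N"
proof -
  have "s < a" "s - \<Delta> < a"
    using a inverse_k_pos delay_nonneg by linarith+
  have "a < m" "m < b"
    using m zero by (auto simp: less_le)
  have crit: "x' m = 0"
  proof (rule DERIV_local_max)
    show "(x has_real_derivative x' m) (at m)"
      using \<open>a < m\<close> \<open>s - \<Delta> < a\<close> by (intro deriv_at) auto
    show "0 < min (m - a) (b - m)" using \<open>a < m\<close> \<open>m < b\<close> by simp
    show "\<forall>y. \<bar>m - y\<bar> < min (m - a) (b - m) \<longrightarrow> x y \<le> x m"
    proof (intro allI impI)
      fix y assume "\<bar>m - y\<bar> < min (m - a) (b - m)"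
      then show "x y \<le> x m" using max[of y] by (auto simp: abs_less_iff)
    qed
  qed
  have cont: "continuous_on {a..m} x"
    using continuous by (rule continuous_on_subset) (use \<open>s - \<Delta> < a\<close> in auto)
  have "closed ({a..m} \<inter> x -` {0})"
    by (intro continuous_closed_preimage[OF cont]) auto
  then have "compact ({a..m} \<inter> x -` {0})"
    by (meson bounded_closed_interval bounded_Int compact_eq_bounded_closed)
  \<comment> \<open>The zero set in \<open>{a..m}\<close> is compact and contains \<open>a\<close>,
    so a last zero exists; by the intermediate value theorem \<open>x\<close> is positive after
    it.\<close>
  then obtain d where d: "d \<in> {a..m}" "x d = 0" and d_max: "\<And>t. t \<in> {a..m} \<Longrightarrow> x t = 0 \<Longrightarrow> t \<le> d"
    using compact_attains_sup[of "{a..m} \<inter> x -` {0}"] zero m by fastforce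
  have pos: "0 < x t" if dt: "d < t" "t \<le> m" for t
  proof (rule ccontr)
    assume "\<not> 0 < x t"
    moreover have "continuous_on {t..m} x"
      using cont by (rule continuous_on_subset) (use dt d in auto)
    ultimately obtain z where "t \<le> z" "z \<le> m" "x z = 0"
      using IVT'[of x t 0 m] m dt by auto
    then show False using d_max[of z] dt d by auto
  qed
  have "x m \<le> 97 / 100 * max N (x m)"
  proof (rule bump_le[OF d(2) _ _ pos crit])
    show "\<bar>x t\<bar> \<le> max N (x m)" if "d - 1 / k - \<Delta> \<le> t" "t \<le> d" for t
    proof (cases "t \<le> a")
      case True
      then show ?thesis using bd[of t] that d by (auto simp: le_max_iff_disj)
    next
      case False
      then show ?thesis using max[of t] that d m by (auto simp: le_max_iff_disj)
    qed
  qed (use a d in auto)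
  then show ?thesis using m by (auto simp: max_def split: if_splits)
qed

section \<open>Contraction of the sup norm and decay\<close>

text \<open>Oscillation supplies a zero \<open>b\<close> beyond \<open>t\<close>, so the maximum of
  \<open>\<bar>x\<bar>\<close> over \<open>{a..b}\<close>, unless zero, is attained strictly between
  two zeros. \<open>positive_max_le\<close> then applies to \<open>x\<close> or
  \<open>- x\<close>.\<close>

lemma decay_after_zero:
  assumes osc: "oscillatory x" and zero: "x a = 0" and a: "s < a - 1 / k"
    and bd: "\<And>t. a - 1 / k - \<Delta> \<le> t \<Longrightarrow> t \<le> a \<Longrightarrow> \<bar>x t\<bar> \<le> N"
    and "a \<le> t"
  shows "\<bar>x t\<bar> \<le> 97 / 100 * N"
proof -
  interpret neg: delayed_growth "\<lambda>t. - x t" "\<lambda>t. - x' t" s \<Delta> k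
    by (rule uminus)
  have "N \<ge> 0"
    using bd[of a] abs_ge_zero[of "x a"] inverse_k_pos delay_nonneg by (smt (verit))
  have "s - \<Delta> < a"
    using a inverse_k_pos delay_nonneg by linarith
  obtain b where b: "t \<le> b" "x b = 0"
    using osc unfolding oscillatory_def by blast
  have "continuous_on {a..b} (\<lambda>t. \<bar>x t\<bar>)"
    using continuous_on_subset[OF continuous] \<open>s - \<Delta> < a\<close>
    by (intro continuous_intros) auto
  then obtain m where m: "m \<in> {a..b}" and max: "\<And>t. t \<in> {a..b} \<Longrightarrow> \<bar>x t\<bar> \<le> \<bar>x m\<bar>"
    using continuous_attains_sup[of "{a..b}" "\<lambda>t. \<bar>x t\<bar>"] b \<open>a \<le> t\<close> by auto
  have "\<bar>x m\<bar> \<le> 97 / 100 * N"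
  proof (cases "x m" "0 :: real" rule: linorder_cases)
    case greater
    then show ?thesis
      using positive_max_le[OF zero b(2) a _ _ greater _ bd] m max by auto
  next
    case less
    then show ?thesis
      using neg.positive_max_le[of a b m N] zero b a m max bd by auto
  qed (use \<open>N \<ge> 0\<close> in auto)
  then show ?thesis using max[of t] \<open>a \<le> t\<close> b by auto
qed

lemma bounded_and_decay:
  assumes osc: "oscillatory x"
  shows "bounded (x ` {s - \<Delta>..})" and "(x \<longlongrightarrow> 0) at_top"
proof -
  obtain a where "s + 1 / k + 1 \<le> a" and zero: "x a = 0"
    using osc unfolding oscillatory_def by blast
  then have a: "s < a - 1 / k" by simp
  have "continuous_on {s - \<Delta>..a} x"
    using continuous by (rule continuous_on_subset) auto
  then have "bounded (x ` {s - \<Delta>..a})"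
    by (intro compact_imp_bounded compact_continuous_image) auto
  then obtain B where "B > 0" and B: "\<And>t. s - \<Delta> \<le> t \<Longrightarrow> t \<le> a \<Longrightarrow> \<bar>x t\<bar> \<le> B"
    unfolding bounded_pos by auto
  have le_B: "\<bar>x t\<bar> \<le> B" if "s - \<Delta> \<le> t" for t
  proof (cases "t \<le> a")
    case False
    then have "\<bar>x t\<bar> \<le> 97 / 100 * B"
      using a by (intro decay_after_zero[OF osc zero a B]) auto
    then show ?thesis using \<open>B > 0\<close> by simp
  qed (use B that in auto)
  then show "bounded (x ` {s - \<Delta>..})"
    by (auto simp: bounded_iff)
  \<comment> \<open>Each round waits for a zero \<open>d\<close> so late that its window from
    \<open>d - 1 / k - \<Delta>\<close> to \<open>d\<close> lies beyond the previous
    \<open>T\<close>, and gains a factor \<open>97 / 100\<close>.\<close>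
  have "\<exists>T\<ge>s - \<Delta>. \<forall>t\<ge>T. \<bar>x t\<bar> \<le> (97 / 100) ^ n * B" for n
  proof (induction n)
    case 0
    then show ?case using le_B by auto
  next
    case (Suc n)
    then obtain T where T: "T \<ge> s - \<Delta>" "\<And>t. t \<ge> T \<Longrightarrow> \<bar>x t\<bar> \<le> (97 / 100) ^ n * B"
      by blast
    obtain d where d: "max (T + 1 / k + \<Delta>) (s + 1 / k + 1) \<le> d" "x d = 0"
      using osc unfolding oscillatory_def by blast
    have "\<bar>x t\<bar> \<le> 97 / 100 * ((97 / 100) ^ n * B)" if "t \<ge> d" for t
      using d that T by (intro decay_after_zero[OF osc d(2)]) auto
    moreover have "d \<ge> s - \<Delta>" using d(1) inverse_k_pos delay_nonneg unfolding max.bounded_iff by linarith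
    ultimately show ?case by (auto simp: mult.assoc)
  qed
  then have decay: "eventually (\<lambda>t. \<bar>x t\<bar> \<le> (97 / 100) ^ n * B) at_top" for n
    unfolding eventually_at_top_linorder by blast
  show "(x \<longlongrightarrow> 0) at_top"
  proof (rule tendstoI)
    fix e :: real assume "e > 0"
    obtain n where "(97 / 100 :: real) ^ n < e / B"
      using real_arch_pow_inv[of "e / B" "97 / 100"] \<open>e > 0\<close> \<open>B > 0\<close> by auto
    then have "(97 / 100) ^ n * B < e"
      using \<open>B > 0\<close> by (simp add: field_simps)
    with decay[of n] show "eventually (\<lambda>t. dist (x t) 0 < e) at_top"
      by (auto elim: eventually_mono)
  qed
qed

end

section \<open>From the delay equation to the growth condition\<close>

theorem theorem21:
  fixes \<tau> p x :: "real \<Rightarrow> real" and s \<gamma> :: real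
  assumes "\<tau> \<in> borel_measurable lebesgue" and "ess_bounded \<tau>" and "\<And>t. 0 \<le> \<tau> t"
    and "p \<in> borel_measurable lebesgue" and "ess_bounded p" and "\<And>t. p t \<le> 0"
    and "\<gamma> \<in> {sqrt 2..pi / 2}" and "Psi 1 \<gamma> = \<gamma>"
    and "delay_solution s p \<tau> x" and "oscillatory x"
    and "max_delay s \<tau> * sqrt (ess_sup_on UNIV (\<lambda>t. \<bar>p t\<bar>)) \<le> \<gamma>"
  shows "bounded (x ` {s - max_delay s \<tau>..}) \<and>
         (max_delay s \<tau> * sqrt (ess_sup_on UNIV (\<lambda>t. \<bar>p t\<bar>)) < \<gamma> \<longrightarrow> (x \<longlongrightarrow> 0) at_top)"
proof -
  define \<Delta> where "\<Delta> = max_delay s \<tau>"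
  define M where "M = ess_sup_on UNIV (\<lambda>t. \<bar>p t\<bar>)"
  have \<tau>_le: "AE t in lebesgue. s \<le> t \<longrightarrow> \<tau> t \<le> \<Delta>"
    using AE_le_ess_sup_on[OF assms(1,2), of "{s..}"] by (simp add: \<Delta>_def max_delay_def)
  have "ess_bounded (\<lambda>t. \<bar>p t\<bar>)"
    using \<open>ess_bounded p\<close> by (simp add: ess_bounded_def)
  then have p_le: "AE t in lebesgue. \<bar>p t\<bar> \<le> M"
    using AE_le_ess_sup_on[of "\<lambda>t. \<bar>p t\<bar>" UNIV] \<open>p \<in> borel_measurable lebesgue\<close>
    by (simp add: M_def)
  have "0 \<le> \<Delta>"
  proof (rule ccontr)
    assume "\<not> 0 \<le> \<Delta>"
    \<comment> \<open>A negative essential supremum would make \<open>{s..}\<close> null. Phrased as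
      membership in a closed set, this passes from almost every to every point of the open
      half-line.\<close>
    with \<tau>_le have "AE t in lebesgue. t \<in> {s..} \<longrightarrow> t \<in> {..s}"
      by (auto elim!: eventually_mono) (smt (verit) assms(3))
    then have "AE t in lebesgue. t \<in> {s<..} \<longrightarrow> t \<in> {..s}"
      by (auto elim!: eventually_mono)
    then have "s + 1 \<in> {..s}"
      by (rule mem_closed_if_AE_lebesgue_open[rotated 2]) auto
    then show False by simp
  qed
  \<comment> \<open>Since \<open>1 / k\<close> is a length, \<open>k\<close> must be positive:
    \<open>sqrt M\<close> serves when \<open>M > 0\<close>, and otherwise any positive
    \<open>k\<close> with \<open>k * \<Delta> \<le> 1\<close> does.\<close>
  obtain k where "0 < k" "M \<le> k\<^sup>2" "k * \<Delta> \<le> 1571 / 1000"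
  proof (cases "M > 0")
    case True
    have "sqrt M * \<Delta> \<le> pi / 2"
      using assms(7,11) by (simp add: \<Delta>_def M_def mult.commute)
    then have "sqrt M * \<Delta> \<le> 1571 / 1000"
      using pi_approx(2) by simp
    with True show ?thesis by (intro that[of "sqrt M"]) auto
  next
    case False
    then have "M \<le> (1 / (\<Delta> + 1))\<^sup>2"
      by (meson not_less order.trans zero_le_power2)
    moreover have "1 / (\<Delta> + 1) * \<Delta> \<le> 1571 / 1000"
      using \<open>0 \<le> \<Delta>\<close> by (simp add: divide_le_eq)
    ultimately show ?thesis
      using \<open>0 \<le> \<Delta>\<close> by (intro that[of "1 / (\<Delta> + 1)"]) auto
  qed
  obtain x' where
    deriv: "\<And>t. t \<ge> s - \<Delta> \<Longrightarrow> (x has_real_derivative x' t) (at t within {s - \<Delta>..})"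
    and ac: "ac_on_halfline (s - \<Delta>) x'"
    and "AE t in lebesgue_on {s..}. \<exists>x''. (x' has_real_derivative x'') (at t) \<and> x'' + p t * x (t - \<tau> t) = 0"
    using \<open>delay_solution s p \<tau> x\<close> unfolding delay_solution_def \<Delta>_def by blast
  then have eq: "AE t in lebesgue. s \<le> t \<longrightarrow>
      (\<exists>x''. (x' has_real_derivative x'') (at t) \<and> x'' + p t * x (t - \<tau> t) = 0)"
    by (simp add: AE_restrict_space_iff)
  \<comment> \<open>The witnesses are \<open>q = - p t\<close>, nonnegative by the sign of
    \<open>p\<close>, and \<open>u = t - \<tau> t\<close>.\<close>
  interpret delayed_growth x x' s \<Delta> k
  proof
    show "AE t in lebesgue. s \<le> t \<longrightarrow> (\<exists>q u. 0 \<le> q \<and> q \<le> k\<^sup>2 \<and> t - \<Delta> \<le> u \<and> u \<le> t \<and>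
        (x' has_real_derivative q * x u) (at t))"
      using eq \<tau>_le p_le
    proof eventually_elim
      case (elim t)
      show ?case
      proof
        assume "s \<le> t"
        then obtain x'' where x'': "(x' has_real_derivative x'') (at t)" "x'' + p t * x (t - \<tau> t) = 0"
          using elim by blast
        then have "x'' = - p t * x (t - \<tau> t)" by simp
        with x'' have "(x' has_real_derivative - p t * x (t - \<tau> t)) (at t)" by simp
        moreover have "0 \<le> - p t" "- p t \<le> k\<^sup>2"
          using assms(6)[of t] elim \<open>M \<le> k\<^sup>2\<close> by auto
        moreover have "t - \<Delta> \<le> t - \<tau> t" "t - \<tau> t \<le> t"
          using elim \<open>s \<le> t\<close> assms(3)[of t] by auto
        ultimately show "\<exists>q u. 0 \<le> q \<and> q \<le> k\<^sup>2 \<and> t - \<Delta> \<le> u \<and> u \<le> t \<and>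
            (x' has_real_derivative q * x u) (at t)"
          by blast
      qed
    qed
  qed fact+
  show ?thesis
    using bounded_and_decay[OF \<open>oscillatory x\<close>] by (simp add: \<Delta>_def)
qed

end
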